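(* Let $n\geqslant 6$ and $0\leqslant m\leqslant 2n-2$ be integers, let $A$ and $B$ be positive real numbers, and let $g:\mathbb{E}^n\to\mathbb{E}^m$ be a mapping such that, for all $x,y\in\mathbb{E}^n$, the equality $|x-y|=A$ implies $|g(x)-g(y)|=A$, and the equality $|x-y|=\sqrt{2}\,A$ implies $|g(x)-g(y)|=B$. Then $g$ is an isometry, i.e., $|g(x)-g(y)|=|x-y|$ for all $x,y\in\mathbb{E}^n$.
   Context: $\mathbb{E}^k$ denotes Euclidean $k$-space and $|\cdot|$ the Euclidean norm. A mapping is called an isometry if it preserves all distances (surjectivity is not required). No continuity or other regularity of $g$ is assumed. *)

theory Defs
  imports "HOL-Analysis.Analysis"
begin

end

theory Submission
  imports Defs
begin

text \<open>
  Normalise \<open>A = 1\<close>. The vertices \<open>\<plusminus>e\<^sub>i / \<surd>2\<close> of a cross-polytope are mapped to points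
  \<open>a\<^sub>i\<close>, \<open>b\<^sub>i\<close> with \<open>\<bar>a\<^sub>i - b\<^sub>i\<bar> = B\<close> and all other distances \<open>1\<close>. The \<open>n\<close> diagonals
  \<open>a\<^sub>i - b\<^sub>i\<close> are nonzero and pairwise orthogonal, and they are orthogonal to all differences of the
  points \<open>a\<^sub>i + b\<^sub>i\<close>, which are equidistant with squared distance \<open>4 - 2 B\<^sup>2\<close>. If this distance were
  positive, the image would span \<open>n + (n - 1) > m\<close> dimensions; hence \<open>B = \<surd>2\<close>.

  Now unit squares are mapped to unit squares, so for a unit vector \<open>u\<close> the increment
  \<open>D\<^sub>u(x) = g(x + u) - g(x)\<close> does not change when \<open>x\<close> moves orthogonally to \<open>u\<close>. For unit vectors
  \<open>u\<close>, \<open>v\<close> at an angle of 60 degrees, \<open>D\<^sub>u(x) - D\<^sub>v(x) = D\<^bsub>u-v\<^esub>(x + v)\<close> does not change when \<open>x\<close>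
  moves along \<open>u + v\<close>; this makes \<open>D\<^sub>u(x + s u) - D\<^sub>u(x)\<close> independent of \<open>x\<close>, hence additive in \<open>s\<close>,
  and being bounded it vanishes. So \<open>g - g(0)\<close> is additive, and an additive map that preserves the
  length of unit vectors preserves all lengths.
\<close>

section \<open>The image of a cross-polytope\<close>

lemma card_orthogonal_family_le_dim:
  fixes F :: "'i \<Rightarrow> 'b::euclidean_space"
  assumes "\<And>i. i \<in> I \<Longrightarrow> F i \<in> T" "\<And>i. i \<in> I \<Longrightarrow> F i \<noteq> 0"
    and orth: "\<And>i j. i \<in> I \<Longrightarrow> j \<in> I \<Longrightarrow> i \<noteq> j \<Longrightarrow> inner (F i) (F j) = 0"
  shows "card I \<le> dim T"
proof -
  have "inj_on F I"
    using orth assms(2) by (metis inj_onI inner_eq_zero_iff)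
  moreover have "independent (F ` I)"
    using assms by (intro pairwise_orthogonal_independent) (auto simp: pairwise_def orthogonal_def)
  moreover have "F ` I \<subseteq> T" using assms(1) by auto
  ultimately show ?thesis
    by (metis card_image independent_card_le_dim)
qed

text \<open>Because the points are centred, summing the squared distances from \<open>e i\<close>
  cancels the cross term and leaves
  \<open>(N - 1) * \<sigma> = N * (norm (e i))\<^sup>2 + Q\<close>. Summing over \<open>i\<close>
  determines \<open>Q\<close>, hence every norm, and polarisation then gives the inner
  products.\<close>

lemma inner_equidistant_centered:
  fixes e :: "'i \<Rightarrow> 'b::real_inner"
  assumes "finite I" "I \<noteq> {}" and centered: "(\<Sum>i\<in>I. e i) = 0"
    and dist: "\<And>i j. i \<in> I \<Longrightarrow> j \<in> I \<Longrightarrow> i \<noteq> j \<Longrightarrow> (norm (e i - e j))\<^sup>2 = \<sigma>"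
    and "i \<in> I" "j \<in> I" "i \<noteq> j"
  shows "inner (e i) (e j) = - \<sigma> / (2 * card I)"
proof -
  define N where "N = real (card I)"
  define Q where "Q = (\<Sum>i\<in>I. (norm (e i))\<^sup>2)"
  have N: "N > 0" using assms(1,2) by (simp add: N_def card_gt_0_iff)
  have *: "(N - 1) * \<sigma> = N * (norm (e i))\<^sup>2 + Q" if "i \<in> I" for i
  proof -
    have "(\<Sum>j\<in>I. (norm (e i - e j))\<^sup>2) = (\<Sum>j\<in>I - {i}. (norm (e i - e j))\<^sup>2)"
      using sum.remove[OF assms(1) that, of "\<lambda>j. (norm (e i - e j))\<^sup>2"] by simp
    also have "\<dots> = (\<Sum>j\<in>I - {i}. \<sigma>)"
      using dist[OF that] by (intro sum.cong) auto
    also have "\<dots> = (N - 1) * \<sigma>"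
      using that assms(1) by (simp add: N_def card_Diff_singleton of_nat_diff Suc_leI card_gt_0_iff[THEN iffD2] ex_in_conv[symmetric] exI[of _ i])
    finally have 1: "(\<Sum>j\<in>I. (norm (e i - e j))\<^sup>2) = (N - 1) * \<sigma>" .
    have "(\<Sum>j\<in>I. (norm (e i - e j))\<^sup>2)
        = (\<Sum>j\<in>I. (norm (e i))\<^sup>2 + (norm (e j))\<^sup>2 - 2 * inner (e i) (e j))"
      by (intro sum.cong refl) (simp add: power2_norm_eq_inner algebra_simps inner_commute)
    also have "\<dots> = N * (norm (e i))\<^sup>2 + Q - 2 * inner (e i) (\<Sum>j\<in>I. e j)"
      by (simp add: sum.distrib sum_subtractf N_def Q_def inner_sum_right sum_distrib_left)
    finally show ?thesis using 1 centered by simp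
  qed
  have "N * Q = (\<Sum>i\<in>I. (N - 1) * \<sigma> - Q)"
    unfolding Q_def[symmetric] using * by (simp add: Q_def sum_distrib_left algebra_simps cong: sum.cong)
  then have "2 * Q = (N - 1) * \<sigma>"
    using N by (simp add: N_def[symmetric])
  then have R: "2 * N * (norm (e i))\<^sup>2 = (N - 1) * \<sigma>" if "i \<in> I" for i
    using *[OF that] by simp
  have "2 * inner (e i) (e j) = (norm (e i))\<^sup>2 + (norm (e j))\<^sup>2 - \<sigma>"
    using dist[OF assms(5-7)] by (simp add: power2_norm_eq_inner algebra_simps inner_commute)
  then have "N * (2 * inner (e i) (e j)) = N * ((norm (e i))\<^sup>2 + (norm (e j))\<^sup>2 - \<sigma>)"
    by simp
  then have "2 * N * inner (e i) (e j) = - \<sigma>"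
    using R[OF assms(5)] R[OF assms(6)] by (simp add: algebra_simps)
  then show ?thesis
    using N by (simp add: N_def field_simps)
qed

lemma cross_polytope_diagonal:
  fixes a b :: "'i \<Rightarrow> 'b::euclidean_space"
  assumes I: "finite I" "card I \<ge> 2" and dim: "dim S + 1 < 2 * card I" and S: "subspace S"
    and "\<And>i. a i \<in> S" "\<And>i. b i \<in> S" and "B > 0"
    and diag: "\<And>i. i \<in> I \<Longrightarrow> norm (a i - b i) = B"
    and aa: "\<And>i j. i \<in> I \<Longrightarrow> j \<in> I \<Longrightarrow> i \<noteq> j \<Longrightarrow> norm (a i - a j) = 1"
    and ab: "\<And>i j. i \<in> I \<Longrightarrow> j \<in> I \<Longrightarrow> i \<noteq> j \<Longrightarrow> norm (a i - b j) = 1"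
    and bb: "\<And>i j. i \<in> I \<Longrightarrow> j \<in> I \<Longrightarrow> i \<noteq> j \<Longrightarrow> norm (b i - b j) = 1"
  shows "B = sqrt 2"
proof -
  define c d where "c i = a i + b i" and "d i = a i - b i" for i
  define N where "N = real (card I)"
  have N: "N > 0" and "I \<noteq> {}" using I by (auto simp: N_def)
  note sq = power2_norm_eq_inner inner_add_left inner_add_right inner_diff_left inner_diff_right
    inner_commute
  have aa2: "inner (a i - a j) (a i - a j) = 1" and ab2: "inner (a i - b j) (a i - b j) = 1"
    and bb2: "inner (b i - b j) (b i - b j) = 1"
    if "i \<in> I" "j \<in> I" "i \<noteq> j" for i j
    using aa[OF that] ab[OF that] bb[OF that] by (simp_all add: norm_eq_1)
  have dg2: "inner (a i - b i) (a i - b i) = B\<^sup>2" if "i \<in> I" for i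
    using diag[OF that] by (simp flip: power2_norm_eq_inner)
  \<comment> \<open>\<open>a j\<close> and \<open>b j\<close> are equidistant from
    \<open>a i\<close> and \<open>b i\<close>, so they lie on the perpendicular bisector of these
    two points, as do the midpoints of both diagonals. Differences of points on it are orthogonal to
    \<open>d i\<close>.\<close>
  have dd: "inner (d i) (d j) = 0" if "i \<in> I" "j \<in> I" "i \<noteq> j" for i j
    using aa2[OF that] ab2[OF that] bb2[OF that] ab2[OF that(2,1)] that(3)
    unfolding d_def by (simp add: sq)
  have dc: "inner (d i) (c j - c k) = 0" if "i \<in> I" "j \<in> I" "k \<in> I" for i j k
  proof -
    have *: "inner (d i) (c j - c i) = 0" if "i \<in> I" "j \<in> I" "i \<noteq> j" for i j
      using aa2[OF that] ab2[OF that] bb2[OF that] ab2[OF that(2,1)] that(3)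
      unfolding d_def c_def by (simp add: sq)
    have "inner (d i) (c j - c i) = 0" "inner (d i) (c k - c i) = 0"
      using * that by (cases "i = j"; cases "i = k"; force)+
    then show ?thesis by (simp add: inner_diff_right)
  qed
  \<comment> \<open>Parallelogram law for the unit vectors \<open>a i - a j\<close> and
    \<open>b i - b j\<close>: their sum is \<open>c i - c j\<close>, their difference
    \<open>d i - d j\<close> has squared norm \<open>2 * B\<^sup>2\<close> by
    \<open>dd\<close>.\<close>
  have cc: "(norm (c i - c j))\<^sup>2 = 4 - 2 * B\<^sup>2" if "i \<in> I" "j \<in> I" "i \<noteq> j" for i j
    using aa2[OF that] ab2[OF that] bb2[OF that] ab2[OF that(2,1)] that(3) dg2[OF that(1)] dg2[OF that(2)]
    unfolding c_def by (simp add: sq)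
  have "4 - 2 * B\<^sup>2 \<ge> 0"
  proof -
    obtain i j where "i \<in> I" "j \<in> I" "i \<noteq> j"
      using I by (metis card_le_Suc0_iff_eq not_less_eq_eq numeral_2_eq_2)
    then show ?thesis using cc by (metis zero_le_power2)
  qed
  moreover have "\<not> 4 - 2 * B\<^sup>2 > 0"
  proof
    assume pos: "4 - 2 * B\<^sup>2 > 0"
    \<comment> \<open>This is \<open>N\<close> times the offset of \<open>c i\<close> from the
      centroid. Being a sum of differences, it stays orthogonal to the diagonals; centring makes all
      mutual inner products the same number \<open>- \<tau>\<close>.\<close>
    define e where "e i = (\<Sum>k\<in>I. c i - c k)" for i
    have diff: "e i - e j = N *\<^sub>R (c i - c j)" for i j
      by (simp add: e_def sum_subtractf N_def scaleR_diff_right sum_constant_scaleR)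
    have sum0: "(\<Sum>i\<in>I. e i) = 0"
      by (simp add: e_def sum_subtractf sum_constant_scaleR flip: scaleR_sum_right)
    define \<tau> where "\<tau> = N * (4 - 2 * B\<^sup>2) / 2"
    have \<tau>: "\<tau> > 0" using pos N by (simp add: \<tau>_def)
    have ee: "inner (e i) (e j) = - \<tau>" if "i \<in> I" "j \<in> I" "i \<noteq> j" for i j
    proof -
      have "inner (e i) (e j) = - (N\<^sup>2 * (4 - 2 * B\<^sup>2)) / (2 * card I)"
        by (rule inner_equidistant_centered[OF I(1) \<open>I \<noteq> {}\<close> sum0 _ that])
           (simp add: diff cc power_mult_distrib)
      then show ?thesis using N by (simp add: \<tau>_def N_def power2_eq_square)
    qed
    have de: "inner (d i) (e j) = 0" if "i \<in> I" "j \<in> I" for i j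
      using that dc by (simp add: e_def inner_sum_right)
    \<comment> \<open>The extra coordinate lifts the vertices of the regular simplex to orthogonal vectors.\<close>
    define F :: "'i + 'i \<Rightarrow> 'b \<times> real"
      where "F p = (case p of Inl i \<Rightarrow> (d i, 0) | Inr i \<Rightarrow> (e i, sqrt \<tau>))" for p
    have "card (I <+> I) \<le> dim (S \<times> (UNIV :: real set))"
    proof (rule card_orthogonal_family_le_dim[of _ F])
      show "F p \<in> S \<times> UNIV" for p
        using assms(5,6) S by (auto simp: F_def d_def e_def c_def split: sum.split
            intro!: subspace_sum subspace_diff subspace_add)
      have "d i \<noteq> 0" if "i \<in> I" for i
        using diag[OF that] \<open>B > 0\<close> by (auto simp: d_def)
      then show "F p \<noteq> 0" if "p \<in> I <+> I" for p
        using that \<tau> by (auto simp: F_def zero_prod_def split: sum.split)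
      show "inner (F p) (F q) = 0" if "p \<in> I <+> I" "q \<in> I <+> I" "p \<noteq> q" for p q
        using that \<tau> dd ee de by (auto simp: F_def inner_commute[of "e _" "d _"] split: sum.split)
    qed
    also have "\<dots> = dim S + 1"
      using S by (simp add: dim_Times)
    finally show False using dim I by (simp add: card_Plus)
  qed
  ultimately have "B\<^sup>2 = 2" by simp
  then show ?thesis using \<open>B > 0\<close> by (simp add: real_sqrt_unique)
qed

lemma image_of_diagonal:
  fixes h :: "'a::euclidean_space \<Rightarrow> 'b::euclidean_space"
  assumes "DIM('a) \<ge> 2" "dim S + 1 < 2 * DIM('a)" "subspace S" "\<And>x. h x \<in> S" "B > 0"
    and unit: "\<And>x y. norm (x - y) = 1 \<Longrightarrow> norm (h x - h y) = 1"
    and diag: "\<And>x y. norm (x - y) = sqrt 2 \<Longrightarrow> norm (h x - h y) = B"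
  shows "B = sqrt 2"
proof -
  define p where "p i = (1 / sqrt 2) *\<^sub>R i" for i :: 'a
  have *: "inner (p i) (p i) = 1 / 2" "inner (p i) (p j) = 0" if "i \<in> Basis" "j \<in> Basis" "i \<noteq> j" for i j
    using that by (auto simp: p_def inner_Basis)
  have "norm (p i - - p i) = sqrt 2" if "i \<in> Basis" for i
  proof -
    have "p i - - p i = sqrt 2 *\<^sub>R i"
      by (simp add: p_def real_div_sqrt field_simps flip: scaleR_add_left)
    then show ?thesis using that by simp
  qed
  moreover have "norm (p i - p j) = 1" "norm (p i - - p j) = 1" "norm (- p i - - p j) = 1"
    if "i \<in> Basis" "j \<in> Basis" "i \<noteq> j" for i j
    using *[OF that] *[OF that(2,1)] that(3)
    by (simp_all add: norm_eq_1 inner_diff_left inner_diff_right inner_add_left inner_add_right)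
  ultimately show ?thesis
    using assms(1-5) unit diag
    by (intro cross_polytope_diagonal[of Basis S "\<lambda>i. h (p i)" "\<lambda>i. h (- p i)"]) auto
qed

section \<open>Maps preserving unit squares\<close>

text \<open>The squared parallelogram defect of any quadrilateral is the sum of its squared sides
  minus the squared diagonals, here \<open>4 - 2 - 2\<close>.\<close>

lemma square_closes:
  fixes p q r t :: "'b::real_inner"
  assumes "norm (p - q) = 1" "norm (q - r) = 1" "norm (r - t) = 1" "norm (t - p) = 1"
    and "norm (p - r) = sqrt 2" "norm (q - t) = sqrt 2"
  shows "p + r = q + t"
proof -
  have "(norm (p + r - (q + t)))\<^sup>2
      = (norm (p - q))\<^sup>2 + (norm (q - r))\<^sup>2 + (norm (r - t))\<^sup>2 + (norm (t - p))\<^sup>2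
        - (norm (p - r))\<^sup>2 - (norm (q - t))\<^sup>2"
    by (simp add: power2_norm_eq_inner inner_add_left inner_add_right inner_diff_left
        inner_diff_right inner_commute)
  then show ?thesis using assms by simp
qed

section \<open>Sums of unit vectors and additive maps\<close>

lemma unit_orthogonal_exists:
  fixes u w :: "'a::euclidean_space"
  assumes "DIM('a) \<ge> 3"
  obtains v where "norm v = 1" "inner v u = 0" "inner v w = 0"
proof -
  have "dim {u, w} < DIM('a)"
    using dim_le_card'[of "{u, w}"] card_insert_le_m1[of 2 "{w}" u] assms by simp
  then obtain v where v: "v \<noteq> 0" "\<And>y. y \<in> span {u, w} \<Longrightarrow> orthogonal v y"
    using orthogonal_to_subspace_exists by blast
  then have "inner v u = 0" "inner v w = 0"
    by (simp_all add: orthogonal_def span_base)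
  then show ?thesis
    using that[of "v /\<^sub>R norm v"] v(1) by simp
qed

text \<open>\<open>w\<close> is one diagonal of a rhombus with unit sides. The other diagonal has
  half-length \<open>t\<close>, by Pythagoras, and a direction \<open>v\<close> orthogonal to both
  \<open>u\<close> and \<open>w\<close>, which needs three dimensions.\<close>

lemma sum_of_two_units:
  fixes u w :: "'a::euclidean_space"
  assumes "DIM('a) \<ge> 3" "norm w \<le> 2" "inner w u = 0"
  obtains p q where "norm p = 1" "norm q = 1" "inner p u = 0" "inner q u = 0" "w = p + q"
proof -
  obtain v where v: "norm v = 1" "inner v u = 0" "inner v w = 0"
    using unit_orthogonal_exists[OF assms(1), of u w] by blast
  define t where "t = sqrt (1 - (norm w)\<^sup>2 / 4)"
  have "(norm w)\<^sup>2 \<le> 2\<^sup>2" using assms(2) by (intro power_mono) auto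
  then have t: "t\<^sup>2 = 1 - inner w w / 4" by (simp add: t_def power2_norm_eq_inner)
  have vv: "inner v v = 1" using v(1) by (simp add: norm_eq_1)
  show ?thesis
  proof
    show "w = (w /\<^sub>R 2 + t *\<^sub>R v) + (w /\<^sub>R 2 - t *\<^sub>R v)"
      by (simp flip: scaleR_add_left)
    show "norm (w /\<^sub>R 2 + t *\<^sub>R v) = 1" "norm (w /\<^sub>R 2 - t *\<^sub>R v) = 1"
      using v(3) t vv by (simp_all add: norm_eq_1 inner_add_left inner_add_right inner_diff_left
          inner_diff_right inner_commute[of w v] power2_eq_square)
  qed (use v(2) assms(3) in \<open>simp_all add: inner_add_left inner_diff_left\<close>)
qed

text \<open>For large \<open>k\<close> the vector \<open>w /\<^sub>R real k\<close> is a sum of two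
  units, so \<open>w\<close> is reached in \<open>k\<close> double steps. Taking
  \<open>u = 0\<close> lifts the restriction on directions.\<close>

lemma sum_of_units_induct [consumes 2, case_names zero step]:
  fixes u w :: "'a::euclidean_space"
  assumes "DIM('a) \<ge> 3" "inner w u = 0"
    and zero: "P 0"
    and step: "\<And>x p. P x \<Longrightarrow> norm p = 1 \<Longrightarrow> inner p u = 0 \<Longrightarrow> P (x + p)"
  shows "P w"
proof -
  obtain k where k: "norm w < real k" using reals_Archimedean2 by blast
  then have "k > 0" using norm_ge_zero[of w] by (cases k) auto
  define w' where "w' = w /\<^sub>R real k"
  have "norm w' \<le> 2" "inner w' u = 0"
    using k \<open>k > 0\<close> assms(2) by (auto simp: w'_def field_simps)
  then obtain p q where pq: "norm p = 1" "norm q = 1" "inner p u = 0" "inner q u = 0" "w' = p + q"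
    using sum_of_two_units[OF assms(1)] by blast
  have "P (real j *\<^sub>R w')" for j
  proof (induction j)
    case (Suc j)
    then have "P (real j *\<^sub>R w' + p + q)" using step pq by blast
    then show ?case using pq(5) by (simp add: algebra_simps)
  qed (simp add: zero)
  from this[of k] show ?thesis using \<open>k > 0\<close> by (simp add: w'_def)
qed

text \<open>Without continuity, additivity is used only through natural multiples; bounds on the
  image lengths replace real homogeneity.\<close>

lemma additive_norm_preserving:
  fixes h :: "'a::euclidean_space \<Rightarrow> 'b::real_normed_vector"
  assumes dim: "DIM('a) \<ge> 3" and add: "\<And>x y. h (x + y) = h x + h y"
    and unit: "\<And>u. norm u = 1 \<Longrightarrow> norm (h u) = 1"
  shows "norm (h w) = norm w"
proof (cases "w = 0")
  case True
  then show ?thesis using add[of 0 0] by simp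
next
  case False
  have h0: "h 0 = 0" using add[of 0 0] by simp
  have mult: "h (real k *\<^sub>R x) = real k *\<^sub>R h x" for k x
    by (induction k) (simp_all add: h0 add algebra_simps)
  have le2: "norm (h x) \<le> 2" if x: "norm x \<le> 2" for x
  proof -
    obtain p q where "norm p = 1" "norm q = 1" "x = p + q"
      using sum_of_two_units[OF dim x, of 0] by auto
    then show ?thesis using unit norm_triangle_ineq[of "h p" "h q"] by (simp add: add)
  qed
  have unit_sgn: "norm (h (sgn x)) = 1" if "x \<noteq> 0" for x
    using that by (intro unit) (simp add: norm_sgn)
  have upper2: "norm (h x) \<le> norm x + 2" for x
  proof (cases "x = 0")
    case nz: False
    define k where "k = nat \<lfloor>norm x\<rfloor>"
    have k: "real k \<le> norm x" "norm x < real k + 1"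
      using floor_correct[of "norm x"] by (auto simp: k_def)
    have "x = real k *\<^sub>R sgn x + (norm x - real k) *\<^sub>R sgn x"
      using nz by (simp add: sgn_div_norm algebra_simps)
    then have "h x = real k *\<^sub>R h (sgn x) + h ((norm x - real k) *\<^sub>R sgn x)"
      using add mult by metis
    moreover have "norm (h ((norm x - real k) *\<^sub>R sgn x)) \<le> 2"
      using k nz by (intro le2) (simp add: norm_sgn)
    ultimately have "norm (h x) \<le> real k + 2"
      using unit_sgn[OF nz] by (metis add_mono mult.right_neutral norm_scaleR norm_triangle_le
          order_refl abs_of_nat)
    then show ?thesis using k by simp
  qed (simp add: h0)
  \<comment> \<open>Applied to large multiples of \<open>x\<close>, the bound \<open>upper2\<close>
    loses its additive error 2.\<close>
  have upper: "norm (h x) \<le> norm x" for x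
  proof (rule ccontr)
    assume "\<not> ?thesis"
    then obtain k :: nat where "2 < real k * (norm (h x) - norm x)"
      using ex_less_of_nat_mult[of "norm (h x) - norm x" 2] by auto
    then show False using upper2[of "real k *\<^sub>R x"] by (simp add: mult algebra_simps)
  qed
  \<comment> \<open>Lower bound: extend \<open>w\<close> along its ray to length \<open>k\<close>.
    The image of the endpoint has length exactly \<open>k\<close>, and the added piece contributes
    at most \<open>real k - norm w\<close>.\<close>
  obtain k where k: "norm w \<le> real k" using real_arch_simple by blast
  have "real k *\<^sub>R sgn w = w + (real k - norm w) *\<^sub>R sgn w"
    using False by (simp add: sgn_div_norm algebra_simps)
  then have "real k *\<^sub>R h (sgn w) = h w + h ((real k - norm w) *\<^sub>R sgn w)"
    using add mult by metis
  then have "norm (real k *\<^sub>R h (sgn w)) \<le> norm (h w) + norm (h ((real k - norm w) *\<^sub>R sgn w))"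
    by (simp add: norm_triangle_ineq)
  also have "norm (h ((real k - norm w) *\<^sub>R sgn w)) \<le> real k - norm w"
    using upper[of "(real k - norm w) *\<^sub>R sgn w"] k False by (simp add: norm_sgn)
  finally show ?thesis using upper[of w] unit_sgn[OF False] by simp
qed

section \<open>Increments along unit vectors\<close>

locale unit_square_preserving =
  fixes g :: "'a::euclidean_space \<Rightarrow> 'b::real_inner"
  assumes dim: "DIM('a) \<ge> 3"
    and unit: "norm (x - y) = 1 \<Longrightarrow> norm (g x - g y) = 1"
    and diag: "norm (x - y) = sqrt 2 \<Longrightarrow> norm (g x - g y) = sqrt 2"
begin

definition D :: "'a \<Rightarrow> 'a \<Rightarrow> 'b" where
  "D u x = g (x + u) - g x"

lemma norm_D: "norm u = 1 \<Longrightarrow> norm (D u x) = 1"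
  unfolding D_def by (rule unit) simp

lemma D_orthogonal:
  assumes "norm u = 1" "inner w u = 0"
  shows "D u (x + w) = D u x"
  using dim assms(2)
proof (induction w rule: sum_of_units_induct)
  case (step w v)
  let ?y = "x + w"
  \<comment> \<open>These are the diagonals of the unit square spanned by \<open>u\<close> and
    \<open>v\<close> at \<open>?y\<close>; its image closes up as a parallelogram.\<close>
  have "norm (u + v) = sqrt 2" "norm (u - v) = sqrt 2"
    using step(2,3) assms(1) by (simp_all add: norm_eq_sqrt_inner inner_add_left inner_add_right
        inner_diff_left inner_diff_right inner_commute)
  then have "g ?y + g (?y + u + v) = g (?y + u) + g (?y + v)"
    using assms(1) step(2)
    by (intro square_closes unit diag) (simp_all add: norm_minus_commute add.commute)
  then have "D u (?y + v) = D u ?y" by (simp add: D_def algebra_simps)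
  then show ?case using step(1) by (simp add: add.assoc)
qed simp

lemma D_const:
  assumes u: "norm u = 1"
  shows "D u x = D u y"
proof -
  obtain p where p: "norm p = 1" "inner p u = 0"
    using unit_orthogonal_exists[OF dim, of u u] by blast
  \<comment> \<open>At 60 degrees to \<open>u\<close>, so that \<open>u - v\<close> is again a unit
    vector.\<close>
  define v where "v = (1/2) *\<^sub>R u + (sqrt 3 / 2) *\<^sub>R p"
  have uu: "inner u u = 1" and pp: "inner p p = 1" using u p by (simp_all add: norm_eq_1)
  have uv: "inner u v = 1/2" and vv: "inner v v = 1"
    using uu pp p(2) by (simp_all add: v_def inner_add_left inner_add_right inner_commute[of u p])
  have vu: "inner v u = 1/2" using uv by (simp add: inner_commute)
  have v1: "norm v = 1" and uv1: "norm (u - v) = 1"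
    using uu uv vv vu by (simp_all add: norm_eq_1 inner_diff_left inner_diff_right)
  have 1: "D u (x + s *\<^sub>R u) - D u x = D v (x + s *\<^sub>R v) - D v x" for x s
  proof -
    \<comment> \<open>The multiple of \<open>u + v\<close> whose components along \<open>u\<close>
      and along \<open>v\<close> both equal \<open>s\<close>; it is orthogonal to
      \<open>u - v\<close>.\<close>
    define q where "q = (2 * s / 3) *\<^sub>R (u + v)"
    have q: "inner (q - s *\<^sub>R u) u = 0" "inner (q - s *\<^sub>R v) v = 0" "inner q (u - v) = 0"
      using uu uv vv vu by (simp_all add: q_def inner_diff_left inner_diff_right inner_add_left)
    have "D u (x + q) = D u (x + s *\<^sub>R u)"
      using D_orthogonal[OF u q(1), of "x + s *\<^sub>R u"] by simp
    moreover have "D v (x + q) = D v (x + s *\<^sub>R v)"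
      using D_orthogonal[OF v1 q(2), of "x + s *\<^sub>R v"] by simp
    moreover have "D u (x + q) - D v (x + q) = D u x - D v x"
    proof -
      have *: "D u z - D v z = D (u - v) (z + v)" for z
        by (simp add: D_def algebra_simps)
      have "D (u - v) (x + q + v) = D (u - v) (x + v)"
        using D_orthogonal[OF uv1 q(3), of "x + v"] by (simp add: add_ac)
      then show ?thesis by (simp only: *)
    qed
    ultimately show ?thesis by (simp add: algebra_simps)
  qed
  have 2: "D u (x + c *\<^sub>R u + s *\<^sub>R u) - D u (x + c *\<^sub>R u) = D u (x + s *\<^sub>R u) - D u x" for x c s
  proof -
    \<comment> \<open>Orthogonal to \<open>v\<close> with component \<open>c\<close> along
      \<open>u\<close>: shifting by \<open>y\<close> acts on \<open>D u\<close> like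
      \<open>c *\<^sub>R u\<close> and leaves \<open>D v\<close> unchanged.\<close>
    define y where "y = (4 * c / 3) *\<^sub>R (u - (1/2) *\<^sub>R v)"
    have y: "inner y v = 0" "inner (y - c *\<^sub>R u) u = 0"
      using uu uv vv vu by (simp_all add: y_def inner_diff_left)
    have Dy: "D u (z + y) = D u (z + c *\<^sub>R u)" for z
      using D_orthogonal[OF u y(2), of "z + c *\<^sub>R u"] by simp
    then have "D u (x + c *\<^sub>R u + s *\<^sub>R u) - D u (x + c *\<^sub>R u) = D u (x + y + s *\<^sub>R u) - D u (x + y)"
      using Dy[of x] Dy[of "x + s *\<^sub>R u"] by (simp add: add_ac)
    also have "\<dots> = D v (x + s *\<^sub>R v + y) - D v (x + y)"
      using 1[of "x + y" s] by (simp add: add_ac)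
    also have "\<dots> = D v (x + s *\<^sub>R v) - D v x"
      using D_orthogonal[OF v1 y(1)] by simp
    finally show ?thesis using 1 by simp
  qed
  have 3: "D u (x + (real k * s) *\<^sub>R u) - D u x = real k *\<^sub>R (D u (x + s *\<^sub>R u) - D u x)" for k x s
  proof (induction k)
    case (Suc k)
    have "D u (x + (real (Suc k) * s) *\<^sub>R u) - D u (x + (real k * s) *\<^sub>R u) = D u (x + s *\<^sub>R u) - D u x"
      using 2[of x "real k * s" s] by (simp add: algebra_simps)
    from arg_cong2[OF this Suc, of "(+)"] show ?case
      by (simp add: scaleR_add_left)
  qed simp
  \<comment> \<open>By \<open>3\<close> a nonzero change would grow linearly in \<open>k\<close>,
    whereas two values of \<open>D u\<close> differ by at most 2 in norm.\<close>
  have 4: "D u (x + s *\<^sub>R u) = D u x" for x s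
  proof (rule ccontr)
    let ?e = "D u (x + s *\<^sub>R u) - D u x"
    assume "\<not> ?thesis"
    then obtain k :: nat where k: "2 < real k * norm ?e"
      using ex_less_of_nat_mult[of "norm ?e" 2] by auto
    have "norm (real k *\<^sub>R ?e) \<le> norm (D u (x + (real k * s) *\<^sub>R u)) + norm (D u x)"
      unfolding 3[symmetric] by (rule norm_triangle_ineq4)
    then show False using k norm_D[OF u] by simp
  qed
  define c where "c = inner (y - x) u"
  have "inner (y - x - c *\<^sub>R u) u = 0" using uu by (simp add: c_def inner_diff_left)
  from D_orthogonal[OF u this, of "x + c *\<^sub>R u"] show ?thesis by (simp add: 4)
qed

lemma increment_const: "g (x + w) - g x = g (y + w) - g y"
proof -
  \<comment> \<open>The induction is run with \<open>u = 0\<close>, to which every \<open>w\<close>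
    is orthogonal.\<close>
  have "\<forall>x y. g (x + w) - g x = g (y + w) - g y"
    using dim inner_zero_right[of w]
  proof (induction w rule: sum_of_units_induct)
    case (step w p)
    show ?case
    proof (intro allI)
      fix x y
      have "g (x + (w + p)) - g x = D p (x + w) + (g (x + w) - g x)" for x
        by (simp add: D_def add.assoc)
      then show "g (x + (w + p)) - g x = g (y + (w + p)) - g y"
        using D_const[OF step(2), of "x + w" "y + w"] step(1) by metis
    qed
  qed simp
  then show ?thesis by blast
qed

lemma isometry: "norm (g x - g y) = norm (x - y)"
proof -
  define h where "h w = g w - g 0" for w
  have inc: "g (y + w) - g y = h w" for y w
    using increment_const[of y w 0] by (simp add: h_def)
  have "norm (h (x - y)) = norm (x - y)"
  proof (rule additive_norm_preserving[OF dim])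
    show "h (v + w) = h v + h w" for v w
      using inc[of v w] by (simp add: h_def algebra_simps)
    show "norm (h u) = 1" if "norm u = 1" for u
      using that unit[of u 0] by (simp add: h_def)
  qed
  then show ?thesis using inc[of y "x - y"] by simp
qed

end

section \<open>Rescaling to unit distance\<close>

theorem theorem2:
  fixes g :: "real ^ 'n \<Rightarrow> real ^ 'k"
    and S :: "(real ^ 'k) set"
    and m :: nat
    and A B :: real
  assumes "CARD('n) \<ge> 6"
    and "m \<le> 2 * CARD('n) - 2"
    and "subspace S" and "dim S = m"
    and "\<And>x. g x \<in> S"
    and "A > 0" and "B > 0"
    and "\<And>x y. norm (x - y) = A \<Longrightarrow> norm (g x - g y) = A"
    and "\<And>x y. norm (x - y) = sqrt 2 * A \<Longrightarrow> norm (g x - g y) = B"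
  shows "\<forall>x y. norm (g x - g y) = norm (x - y)"
proof -
  define h where "h x = g (A *\<^sub>R x) /\<^sub>R A" for x
  have hh: "norm (h x - h y) = norm (g (A *\<^sub>R x) - g (A *\<^sub>R y)) / A"
    and scale: "norm (A *\<^sub>R x - A *\<^sub>R y) = A * norm (x - y)" for x y
    using \<open>A > 0\<close> by (simp_all add: h_def divide_inverse mult.commute flip: scaleR_diff_right)
  have unit: "norm (h x - h y) = 1" if "norm (x - y) = 1" for x y
    using assms(8)[of "A *\<^sub>R x" "A *\<^sub>R y"] that \<open>A > 0\<close> by (simp add: hh scale)
  have diag: "norm (h x - h y) = B / A" if "norm (x - y) = sqrt 2" for x y
    using assms(9)[of "A *\<^sub>R x" "A *\<^sub>R y"] that \<open>A > 0\<close> by (simp add: hh scale mult.commute)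
  \<comment> \<open>The subspace \<open>S\<close> stands for the target space; this form also admits
    \<open>m = 0\<close>, which no type \<open>real ^ 'k\<close> has as its dimension.\<close>
  have "h x \<in> S" for x
    using assms(3,5) by (simp add: h_def subspace_scale)
  \<comment> \<open>The bound on \<open>m\<close> is exactly
    \<open>dim S + 1 < 2 * CARD('n)\<close>, the room that the cross-polytope argument
    excludes.\<close>
  then have "B / A = sqrt 2"
    using assms(1-4,6,7) unit diag by (intro image_of_diagonal[of S h]) auto
  then interpret unit_square_preserving h
    using assms(1) unit diag by unfold_locales auto
  show ?thesis
  proof (intro allI)
    fix x y
    show "norm (g x - g y) = norm (x - y)"
      using isometry[of "x /\<^sub>R A" "y /\<^sub>R A"] scale[of "x /\<^sub>R A" "y /\<^sub>R A"]
        hh[of "x /\<^sub>R A" "y /\<^sub>R A"] \<open>A > 0\<close>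
      by (simp add: divide_eq_eq mult.commute)
  qed
qed

end
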